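(* Let $\hat\theta$ denote any one of the estimators $\hat\theta_H$, $\hat\theta_S$, or $\hat\theta_{SCAD}$, and write $F_{n,\theta}$ for the cdf of $n^{1/2}(\hat\theta-\theta)$ under $P_{n,\theta}$. Consider a sequence of tuning parameters such that $\eta_n\to0$ and $n^{1/2}\eta_n\to e$ as $n\to\infty$ with $0\le e\le\infty$. Let $t\in\mathbb{R}$ be arbitrary. Then every consistent estimator $\hat F_n(t)$ of $F_{n,\theta}(t)$ satisfies $$\lim_{n\to\infty}\sup_{|\theta|<c/n^{1/2}}P_{n,\theta}\left(\left|\hat F_n(t)-F_{n,\theta}(t)\right|>\varepsilon\right)=1$$ for each $\varepsilon<(\Phi(t+e)-\Phi(t-e))/2$ and each $c>|t|$. In particular, no uniformly consistent estimator for $F_{n,\theta}(t)$ exists.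
   Context: For each $n\ge1$ and $\theta\in\mathbb{R}$, $P_{n,\theta}$ is the probability measure under which $y_1,\dots,y_n$ are independent and each $N(\theta,1)$-distributed; $\bar y=n^{-1}\sum_{t=1}^n y_t$. $(\eta_n)$ is a sequence of positive real numbers (tuning parameters). $\boldsymbol{1}(\cdot)$ is the indicator function, $z_+=\max\{z,0\}$, and $\mathrm{sign}(x)=-1,0,1$ for $x<0$, $x=0$, $x>0$, respectively. The estimators (at sample size $n$) are: hard-thresholding $\hat\theta_H=\bar y\,\boldsymbol{1}(|\bar y|>\eta_n)$; soft-thresholding (LASSO) $\hat\theta_S=\mathrm{sign}(\bar y)(|\bar y|-\eta_n)_+$; and, for a fixed constant $a>2$, SCAD: $\hat\theta_{SCAD}=\mathrm{sign}(\bar y)(|\bar y|-\eta_n)_+$ if $|\bar y|\le 2\eta_n$, $\hat\theta_{SCAD}=\{(a-1)\bar y-\mathrm{sign}(\bar y)a\eta_n\}/(a-2)$ if $2\eta_n<|\bar y|\le a\eta_n$, and $\hat\theta_{SCAD}=\bar y$ if $|\bar y|>a\eta_n$. $\Phi$ is the standard normal cdf, with $\Phi(-\infty)=0$, $\Phi(\infty)=1$. An estimator $\hat F_n(t)$ is a (sequence in $n$ of) real-valued measurable function(s) of $y_1,\dots,y_n$. It is consistent for $F_{n,\theta}(t)$ if for every $\theta\in\mathbb{R}$ and every $\delta>0$, $P_{n,\theta}(|\hat F_n(t)-F_{n,\theta}(t)|>\delta)\to0$ as $n\to\infty$; it is uniformly consistent if for every $\delta>0$, $\sup_{\theta\in\mathbb{R}}P_{n,\theta}(|\hat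 F_n(t)-F_{n,\theta}(t)|>\delta)\to0$ as $n\to\infty$.
   Formalization: The "in particular" claim that no uniformly consistent estimator exists is stated only for e > 0; for e = 0 it is false, since F_{n,θ}(t) converges to Φ(t) uniformly in θ and the constant Φ(t) is uniformly consistent. *)

theory Defs
  imports "HOL-Probability.Probability"
begin

text \<open>The canonical model: the sample is the coordinate process of the product space.\<close>

definition sample_measure :: "nat \<Rightarrow> real \<Rightarrow> (nat \<Rightarrow> real) measure" where
  "sample_measure n \<theta> = (\<Pi>\<^sub>M i\<in>{1..n}. density lborel (normal_density \<theta> 1))"

definition sample_mean :: "nat \<Rightarrow> (nat \<Rightarrow> real) \<Rightarrow> real" where
  "sample_mean n y = (\<Sum>i=1..n. y i) / real n"

text \<open>The estimators depend on the data only through the sample mean, their last argument \<open>x\<close>.\<close>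

definition hard_threshold :: "real \<Rightarrow> real \<Rightarrow> real" where
  "hard_threshold \<eta> x = x * (if \<bar>x\<bar> > \<eta> then 1 else 0)"

definition soft_threshold :: "real \<Rightarrow> real \<Rightarrow> real" where
  "soft_threshold \<eta> x = sgn x * max (\<bar>x\<bar> - \<eta>) 0"

definition scad :: "real \<Rightarrow> real \<Rightarrow> real \<Rightarrow> real" where
  "scad a \<eta> x =
    (if \<bar>x\<bar> \<le> 2 * \<eta> then sgn x * max (\<bar>x\<bar> - \<eta>) 0
     else if \<bar>x\<bar> \<le> a * \<eta> then ((a - 1) * x - sgn x * a * \<eta>) / (a - 2)
     else x)"

definition scaled_cdf ::
    "(real \<Rightarrow> real \<Rightarrow> real) \<Rightarrow> (nat \<Rightarrow> real) \<Rightarrow> nat \<Rightarrow> real \<Rightarrow> real \<Rightarrow> real" where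
  "scaled_cdf est \<eta> n \<theta> t =
    cdf (distr (sample_measure n \<theta>) borel
          (\<lambda>y. sqrt (real n) * (est (\<eta> n) (sample_mean n y) - \<theta>))) t"

definition Phi :: "ereal \<Rightarrow> real" where
  "Phi x = (case x of ereal r \<Rightarrow> cdf std_normal_distribution r | PInfty \<Rightarrow> 1 | MInfty \<Rightarrow> 0)"

text \<open>Estimators are indexed by the sample size; the index 0 carries no meaning and is left
  unconstrained.\<close>

definition estimator :: "(nat \<Rightarrow> (nat \<Rightarrow> real) \<Rightarrow> real) \<Rightarrow> bool" where
  "estimator Fhat \<longleftrightarrow> (\<forall>n\<ge>1. Fhat n \<in> borel_measurable (\<Pi>\<^sub>M i\<in>{1..n}. borel))"

definition error_prob ::
    "(nat \<Rightarrow> (nat \<Rightarrow> real) \<Rightarrow> real) \<Rightarrow> (nat \<Rightarrow> real \<Rightarrow> real) \<Rightarrow> nat \<Rightarrow> real \<Rightarrow> real \<Rightarrow> real" where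
  "error_prob Fhat G n \<theta> \<delta> =
    measure (sample_measure n \<theta>)
      {y \<in> space (sample_measure n \<theta>). \<bar>Fhat n y - G n \<theta>\<bar> > \<delta>}"

definition consistent ::
    "(nat \<Rightarrow> (nat \<Rightarrow> real) \<Rightarrow> real) \<Rightarrow> (nat \<Rightarrow> real \<Rightarrow> real) \<Rightarrow> bool" where
  "consistent Fhat G \<longleftrightarrow>
    (\<forall>\<theta>. \<forall>\<delta>>0. (\<lambda>n. error_prob Fhat G n \<theta> \<delta>) \<longlonglongrightarrow> 0)"

definition uniformly_consistent ::
    "(nat \<Rightarrow> (nat \<Rightarrow> real) \<Rightarrow> real) \<Rightarrow> (nat \<Rightarrow> real \<Rightarrow> real) \<Rightarrow> bool" where
  "uniformly_consistent Fhat G \<longleftrightarrow>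
    (\<forall>\<delta>>0. (\<lambda>n. SUP \<theta>. error_prob Fhat G n \<theta> \<delta>) \<longlonglongrightarrow> 0)"

end

theory Submission imports Defs begin

text \<open>
  On the scale \<open>\<theta> = u / sqrt n\<close> the likelihood ratio of \<open>P\<^bsub>n,\<theta>\<^esub>\<close> with respect to
  \<open>P\<^bsub>n,0\<^esub>\<close> has second moment \<open>exp (u\<^sup>2)\<close>, so events whose probability vanishes under
  \<open>P\<^bsub>n,0\<^esub>\<close> also vanish under \<open>P\<^bsub>n,\<theta>\<^esub>\<close>. A consistent estimator is therefore close to
  the single number \<open>F\<^bsub>n,0\<^esub>(t)\<close> along all such local parameters. But \<open>F\<^bsub>n,\<theta>\<^esub>(t)\<close> jumps at
  \<open>u = - t\<close>: all three estimators vanish on \<open>[- \<eta>\<^sub>n, \<eta>\<^sub>n]\<close> and have the sign of the sample mean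
  outside, so \<open>F\<^bsub>n,\<theta>\<^esub>(t)\<close> is at least \<open>\<Phi>(t + sqrt n \<eta>\<^sub>n)\<close> at \<open>u = - t\<close> and at most
  \<open>\<Phi>(t + 1/n - sqrt n \<eta>\<^sub>n)\<close> at \<open>u = - t - 1/n\<close>. At one of these two parameters the error must
  be at least half of the jump.
\<close>

section \<open>The normal location sample and the law of its mean\<close>

lemma sets_sample_measure [simp, measurable_cong]:
  "sets (sample_measure n \<theta>) = sets (\<Pi>\<^sub>M i\<in>{1..n}. borel)"
  unfolding sample_measure_def by (intro sets_PiM_cong) auto

lemma space_sample_measure: "space (sample_measure n \<theta>) = space (\<Pi>\<^sub>M i\<in>{1..n}. borel)"
  by (rule sets_eq_imp_space_eq) simp

lemma prob_space_sample_measure: "prob_space (sample_measure n \<theta>)"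
  unfolding sample_measure_def by (intro prob_space_PiM prob_space_normal_density) simp

lemma measurable_sample_mean [measurable]:
  "sample_mean n \<in> borel_measurable (\<Pi>\<^sub>M i\<in>{1..n}. borel)"
  unfolding sample_mean_def by measurable

lemma distributed_sample_sum:
  assumes "n \<ge> 1"
  shows "distributed (sample_measure n \<theta>) lborel (\<lambda>y. \<Sum>i=1..n. y i) (normal_density (n * \<theta>) (sqrt n))"
proof -
  let ?N = "density lborel (normal_density \<theta> 1)"
  interpret S: prob_space "sample_measure n \<theta>" by (rule prob_space_sample_measure)
  have component: "distr (sample_measure n \<theta>) ?N (\<lambda>y. y i) = ?N" if "i \<in> {1..n}" for i
    unfolding sample_measure_def using that
    by (intro distr_PiM_component prob_space_normal_density) auto
  have component': "distr (sample_measure n \<theta>) borel (\<lambda>y. y i) = ?N" if "i \<in> {1..n}" for i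
    using component[OF that] by (simp cong: distr_cong)
  have "S.indep_vars (\<lambda>i. borel) (\<lambda>i y. y i) {1..n}"
  proof (subst S.indep_vars_iff_distr_eq_PiM')
    \<comment> \<open>Points of the space are undefined outside \<open>{1..n}\<close>, so
      restricting them to \<open>{1..n}\<close> is the identity and the joint law of the coordinates
      is the sample measure itself, a product.\<close>
    have "distr (sample_measure n \<theta>) (\<Pi>\<^sub>M i\<in>{1..n}. borel) (\<lambda>y. \<lambda>i\<in>{1..n}. y i)
        = distr (sample_measure n \<theta>) (sample_measure n \<theta>) (\<lambda>y. y)"
      by (rule distr_cong) (auto simp: space_sample_measure space_PiM PiE_def extensional_def fun_eq_iff)
    also have "\<dots> = (\<Pi>\<^sub>M i\<in>{1..n}. distr (sample_measure n \<theta>) borel (\<lambda>y. y i))"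
      unfolding distr_id2[OF refl] by (subst sample_measure_def, rule PiM_cong) (simp_all add: component')
    finally show "distr (sample_measure n \<theta>) (\<Pi>\<^sub>M i\<in>{1..n}. borel) (\<lambda>y. \<lambda>i\<in>{1..n}. y i)
        = (\<Pi>\<^sub>M i\<in>{1..n}. distr (sample_measure n \<theta>) borel (\<lambda>y. y i))" .
  qed (use assms in auto)
  moreover have "distributed (sample_measure n \<theta>) lborel (\<lambda>y. y i) (normal_density \<theta> 1)"
    if "i \<in> {1..n}" for i
    using component'[OF that] that by (auto simp: distributed_def cong: distr_cong)
  ultimately have "distributed (sample_measure n \<theta>) lborel (\<lambda>y. \<Sum>i=1..n. y i)
      (normal_density (\<Sum>i=1..n. \<theta>) (sqrt (\<Sum>i=1..n. 1\<^sup>2)))"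
    using assms by (intro S.sum_indep_normal) auto
  then show ?thesis by simp
qed

lemma measure_sample_mean_le:
  assumes "n \<ge> 1"
  shows "measure (sample_measure n \<theta>) {y \<in> space (sample_measure n \<theta>). sample_mean n y \<le> x}
    = cdf std_normal_distribution (sqrt n * (x - \<theta>))"
proof -
  interpret S: prob_space "sample_measure n \<theta>" by (rule prob_space_sample_measure)
  have n: "real n > 0" using assms by simp
  let ?Z = "\<lambda>y. ((\<Sum>i=1..n. y i) - n * \<theta>) / sqrt n"
  have Z: "distributed (sample_measure n \<theta>) lborel ?Z std_normal_density"
    using distributed_sample_sum[OF assms, of \<theta>] S.normal_standard_normal_convert[of "sqrt n" _ "n * \<theta>"] n
    by simp
  have "sample_mean n y \<le> x \<longleftrightarrow> ?Z y \<le> sqrt n * (x - \<theta>)" for y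
  proof -
    have "?Z y \<le> sqrt n * (x - \<theta>) \<longleftrightarrow> (\<Sum>i=1..n. y i) - n * \<theta> \<le> sqrt n * (x - \<theta>) * sqrt n"
      using n by (simp add: pos_divide_le_eq)
    also have "sqrt n * (x - \<theta>) * sqrt n = n * (x - \<theta>)"
      by simp
    finally show ?thesis
      using n by (simp add: sample_mean_def pos_divide_le_eq algebra_simps)
  qed
  then have "measure (sample_measure n \<theta>) {y \<in> space (sample_measure n \<theta>). sample_mean n y \<le> x}
      = measure (distr (sample_measure n \<theta>) lborel ?Z) {..sqrt n * (x - \<theta>)}"
    using distributed_measurable[OF Z]
    by (subst measure_distr) (auto intro!: arg_cong[where f = "measure _"])
  then show ?thesis
    by (simp only: distributed_distr_eq_density[OF Z] cdf_def)
qed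

section \<open>Likelihood ratios and local changes of measure\<close>

lemma normal_density_tilt:
  "normal_density \<theta> 1 x = normal_density 0 1 x * exp (\<theta> * x - \<theta>\<^sup>2 / 2)"
  unfolding normal_density_def
  by (simp add: mult_exp_exp[symmetric] exp_add[symmetric] power2_eq_square field_simps)

text \<open>Each coordinate law is tilted by the factor
  \<open>exp (\<theta> * x - \<theta>\<^sup>2 / 2)\<close>. These factors multiply to the
  exponential in the sum, and a product measure is determined by its values on boxes, where the
  integral factorizes.\<close>

lemma sample_measure_likelihood_ratio:
  "sample_measure n \<theta> =
    density (sample_measure n 0) (\<lambda>y. ennreal (exp (\<theta> * (\<Sum>i=1..n. y i) - n * \<theta>\<^sup>2 / 2)))"
proof -
  let ?N = "\<lambda>\<theta>. density lborel (normal_density \<theta> 1)"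
  interpret N: product_sigma_finite "\<lambda>i. ?N \<theta>"
    by (simp add: product_sigma_finite_def prob_space_imp_sigma_finite prob_space_normal_density)
  interpret N0: product_sigma_finite "\<lambda>i. ?N 0"
    by (simp add: product_sigma_finite_def prob_space_imp_sigma_finite prob_space_normal_density)
  let ?l = "\<lambda>x. ennreal (exp (\<theta> * x - \<theta>\<^sup>2 / 2))"
  let ?L = "\<lambda>y. ennreal (exp (\<theta> * (\<Sum>i=1..n. y i) - n * \<theta>\<^sup>2 / 2))"
  have N_eq: "?N \<theta> = density (?N 0) ?l"
    by (subst density_density_eq)
       (auto simp: normal_density_tilt[of \<theta>] ennreal_mult intro!: density_cong)
  have L: "?L y = (\<Prod>i=1..n. ?l (y i))" for y
    by (simp add: prod_ennreal exp_sum[symmetric] sum_subtractf sum_distrib_left)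
  have "density (sample_measure n 0) ?L = (\<Pi>\<^sub>M i\<in>{1..n}. ?N \<theta>)"
  proof (rule N.PiM_eqI)
    fix A assume A: "\<And>i. i \<in> {1..n} \<Longrightarrow> A i \<in> sets (?N \<theta>)"
    have box: "Pi\<^sub>E {1..n} A \<in> sets (sample_measure n 0)"
      unfolding sample_measure_def using A by (intro sets_PiM_I_finite) simp_all
    have "emeasure (density (sample_measure n 0) ?L) (Pi\<^sub>E {1..n} A)
      = (\<integral>\<^sup>+y. ?L y * indicator (Pi\<^sub>E {1..n} A) y \<partial>sample_measure n 0)"
      by (rule emeasure_density[OF _ box]) measurable
    also have "\<dots> = (\<integral>\<^sup>+y. (\<Prod>i=1..n. ?l (y i) * indicator (A i) (y i)) \<partial>sample_measure n 0)"
    proof (rule nn_integral_cong)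
      fix y assume "y \<in> space (sample_measure n 0)"
      \<comment> \<open>\<open>y\<close> is extensional, so lying in the box is a condition on the
        coordinates in \<open>{1..n}\<close> alone.\<close>
      then have "indicator (Pi\<^sub>E {1..n} A) y = (\<Prod>i=1..n. indicator (A i) (y i) :: ennreal)"
        by (auto simp: space_sample_measure space_PiM PiE_iff indicator_def)
      then show "?L y * indicator (Pi\<^sub>E {1..n} A) y = (\<Prod>i=1..n. ?l (y i) * indicator (A i) (y i))"
        by (simp only: L prod.distrib)
    qed
    also have "\<dots> = (\<Prod>i=1..n. \<integral>\<^sup>+x. ?l x * indicator (A i) x \<partial>?N 0)"
      unfolding sample_measure_def using A by (intro N0.product_nn_integral_prod) auto
    also have "\<dots> = (\<Prod>i=1..n. emeasure (?N \<theta>) (A i))"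
      unfolding N_eq using A by (intro prod.cong refl emeasure_density[symmetric]) auto
    finally show "emeasure (density (sample_measure n 0) ?L) (Pi\<^sub>E {1..n} A)
      = (\<Prod>i=1..n. emeasure (?N \<theta>) (A i))" .
  qed (auto intro!: sets_PiM_cong)
  then show ?thesis by (simp add: sample_measure_def)
qed

lemma measure_sample_measure_le:
  assumes A: "A \<in> sets (\<Pi>\<^sub>M i\<in>{1..n}. borel)" and "K > 0"
  shows "measure (sample_measure n \<theta>) A \<le> K * measure (sample_measure n 0) A + exp (n * \<theta>\<^sup>2) / K"
proof -
  define L where "L \<theta> y = exp (\<theta> * (\<Sum>i=1..n. y i) - n * \<theta>\<^sup>2 / 2)" for \<theta> :: real and y :: "nat \<Rightarrow> real"
  have [measurable]: "L \<theta> \<in> borel_measurable (\<Pi>\<^sub>M i\<in>{1..n}. borel)" for \<theta>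
    unfolding L_def by measurable
  note [measurable] = A
  interpret P0: prob_space "sample_measure n 0" by (rule prob_space_sample_measure)
  interpret P: prob_space "sample_measure n \<theta>" by (rule prob_space_sample_measure)
  interpret P2: prob_space "sample_measure n (2 * \<theta>)" by (rule prob_space_sample_measure)
  have P_eq: "sample_measure n \<theta> = density (sample_measure n 0) (\<lambda>y. ennreal (L \<theta> y))" for \<theta>
    unfolding L_def by (rule sample_measure_likelihood_ratio)
  \<comment> \<open>Truncate the likelihood ratio at \<open>K\<close>; its square is again a likelihood ratio up to a constant,
    which gives its second moment without integration.\<close>
  have bound: "L \<theta> y \<le> K + exp (n * \<theta>\<^sup>2) / K * L (2 * \<theta>) y" for y
  proof -
    have sq: "exp (n * \<theta>\<^sup>2) * L (2 * \<theta>) y = (L \<theta> y)\<^sup>2"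
      unfolding L_def power2_eq_square exp_add[symmetric] by (simp add: field_simps)
    have "L \<theta> y \<le> K + (L \<theta> y)\<^sup>2 / K"
    proof (cases "L \<theta> y \<le> K")
      case True then show ?thesis using \<open>K > 0\<close> by (simp add: add_increasing2)
    next
      case False
      then have "L \<theta> y \<le> (L \<theta> y)\<^sup>2 / K"
        using \<open>K > 0\<close> by (simp add: pos_le_divide_eq power2_eq_square)
      then show ?thesis using \<open>K > 0\<close> by linarith
    qed
    then show ?thesis by (simp add: sq[symmetric])
  qed
  have "emeasure (sample_measure n \<theta>) A = (\<integral>\<^sup>+y. ennreal (L \<theta> y) * indicator A y \<partial>sample_measure n 0)"
    unfolding P_eq[of \<theta>] by (intro emeasure_density) measurable
  also have "\<dots> \<le> (\<integral>\<^sup>+y. ennreal K * indicator A y + ennreal (exp (n * \<theta>\<^sup>2) / K) * ennreal (L (2 * \<theta>) y)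
      \<partial>sample_measure n 0)"
    using bound \<open>K > 0\<close>
    by (intro nn_integral_mono)
       (auto simp: ennreal_mult[symmetric] ennreal_plus[symmetric] L_def indicator_def simp del: ennreal_plus intro!: ennreal_leI)
  also have "\<dots> = ennreal K * emeasure (sample_measure n 0) A
      + ennreal (exp (n * \<theta>\<^sup>2) / K) * (\<integral>\<^sup>+y. ennreal (L (2 * \<theta>) y) \<partial>sample_measure n 0)"
    using A by (subst nn_integral_add) (simp_all add: nn_integral_cmult nn_integral_cmult_indicator)
  also have "(\<integral>\<^sup>+y. ennreal (L (2 * \<theta>) y) \<partial>sample_measure n 0) = 1"
  proof -
    have "(\<lambda>y. ennreal (L (2 * \<theta>) y)) \<in> borel_measurable (sample_measure n 0)"
      by measurable
    then have "(\<integral>\<^sup>+y. ennreal (L (2 * \<theta>) y) \<partial>sample_measure n 0)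
        = emeasure (sample_measure n (2 * \<theta>)) (space (sample_measure n 0))"
      unfolding P_eq[of "2 * \<theta>"]
      by (subst emeasure_density[OF _ sets.top]) (auto intro!: nn_integral_cong)
    then show ?thesis
      using P2.emeasure_space_1 by (simp add: space_sample_measure)
  qed
  finally show ?thesis
    using \<open>K > 0\<close>
    by (simp add: P.emeasure_eq_measure P0.emeasure_eq_measure ennreal_mult[symmetric]
        ennreal_plus[symmetric] del: ennreal_plus)
qed


text \<open>Contiguity: parameters of order \<open>1 / sqrt n\<close> keep the second moment of the
  likelihood ratio below \<open>exp (c\<^sup>2)\<close>, so events that become negligible at zero
  remain so along them.\<close>

lemma tendsto_measure_sample_measure_zero:
  fixes \<theta> :: "nat \<Rightarrow> real"
  assumes A: "\<And>n. n \<ge> 1 \<Longrightarrow> A n \<in> sets (\<Pi>\<^sub>M i\<in>{1..n}. borel)"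
    and lim: "(\<lambda>n. measure (sample_measure n 0) (A n)) \<longlonglongrightarrow> 0"
    and bound: "\<And>n. n \<ge> 1 \<Longrightarrow> sqrt n * \<bar>\<theta> n\<bar> \<le> c"
  shows "(\<lambda>n. measure (sample_measure n (\<theta> n)) (A n)) \<longlonglongrightarrow> 0"
proof (rule LIMSEQ_I)
  fix r :: real assume "r > 0"
  \<comment> \<open>Makes \<open>exp (c\<^sup>2) / K\<close> equal to \<open>r / 2\<close>. As
    \<open>K\<close> does not depend on \<open>n\<close>, the other term is eventually below
    \<open>r / 2\<close> too.\<close>
  define K where "K = 2 * exp (c\<^sup>2) / r"
  have "K > 0" using \<open>r > 0\<close> by (simp add: K_def)
  have "\<forall>\<^sub>F n in sequentially. measure (sample_measure n 0) (A n) < r / (2 * K)"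
    using lim \<open>r > 0\<close> \<open>K > 0\<close> by (intro order_tendstoD) auto
  then have "\<forall>\<^sub>F n in sequentially. norm (measure (sample_measure n (\<theta> n)) (A n) - 0) < r"
    using eventually_ge_at_top[of 1]
  proof eventually_elim
    case (elim n)
    have "n * (\<theta> n)\<^sup>2 = (sqrt n * \<bar>\<theta> n\<bar>)\<^sup>2"
      by (simp add: power_mult_distrib)
    also have "\<dots> \<le> c\<^sup>2"
      using bound[OF elim(2)] by (intro power_mono) auto
    finally have "exp (n * (\<theta> n)\<^sup>2) / K \<le> r / 2"
      using \<open>r > 0\<close> by (simp add: K_def field_simps)
    moreover have "K * measure (sample_measure n 0) (A n) < r / 2"
      using elim(1) \<open>K > 0\<close> by (simp add: field_simps)
    ultimately have "measure (sample_measure n (\<theta> n)) (A n) < r"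
      using measure_sample_measure_le[OF A[OF elim(2)] \<open>K > 0\<close>, of "\<theta> n"] by linarith
    then show ?case by simp
  qed
  then show "\<exists>no. \<forall>n\<ge>no. norm (measure (sample_measure n (\<theta> n)) (A n) - 0) < r"
    by (simp add: eventually_sequentially)
qed

section \<open>The standard normal cdf on the extended real line\<close>

lemma tendsto_cdf_Phi:
  assumes "((\<lambda>n. ereal (x n)) \<longlongrightarrow> z) F"
  shows "((\<lambda>n. cdf std_normal_distribution (x n)) \<longlongrightarrow> Phi z) F"
proof -
  interpret N: real_distribution std_normal_distribution by (rule real_dist_normal_dist)
  \<comment> \<open>At a finite limit the cdf is continuous because points carry no mass; at the
    infinite ones the values one and zero in \<open>Phi\<close> are the limits of the cdf.\<close>
  show ?thesis
  proof (cases z)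
    case (real r)
    have "emeasure std_normal_distribution {r} = 0"
      by (simp add: emeasure_density nn_integral_indicator_singleton' emeasure_lborel_singleton)
    then have "isCont (cdf std_normal_distribution) r"
      by (simp add: N.isCont_cdf measure_def)
    then show ?thesis
      using assms real by (auto simp: Phi_def intro: isCont_tendsto_compose)
  next
    case PInf
    then show ?thesis
      using assms N.cdf_lim_at_top_prob
      by (auto simp: Phi_def tendsto_PInfty_eq_at_top intro: filterlim_compose)
  next
    case MInf
    then have "filterlim x at_bot F"
      using assms by (auto simp: tendsto_MInfty filterlim_at_bot_dense)
    then show ?thesis
      using MInf N.cdf_lim_at_bot by (auto simp: Phi_def intro: filterlim_compose)
  qed
qed

text \<open>The density is positive everywhere, so an interval of normal mass zero would have
  Lebesgue measure zero.\<close>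

lemma std_normal_cdf_strict_mono:
  assumes "x < y"
  shows "cdf std_normal_distribution x < cdf std_normal_distribution y"
proof -
  interpret N: real_distribution std_normal_distribution by (rule real_dist_normal_dist)
  have "emeasure std_normal_distribution {x<..y} \<noteq> 0"
  proof
    assume "emeasure std_normal_distribution {x<..y} = 0"
    then have "AE z in lborel. ennreal (std_normal_density z) * indicator {x<..y} z = 0"
      by (simp add: emeasure_density nn_integral_0_iff_AE)
    moreover have "std_normal_density z > 0" for z
      by (rule normal_density_pos) simp
    ultimately have "AE z in lborel. z \<notin> {x<..y}"
      by (auto simp: indicator_def less_le split: if_splits)
    then have "emeasure lborel {x<..y} = 0"
      by (subst (asm) AE_iff_measurable[where N = "{x<..y}"]) auto
    with assms show False by simp
  qed
  then have "measure std_normal_distribution {x<..y} > 0"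
    by (simp add: N.emeasure_eq_measure zero_less_measure_iff)
  then show ?thesis
    using N.cdf_diff_eq[OF assms] by simp
qed

text \<open>Finite arguments have values strictly between zero and one, since a further unit to the
  left or right still changes the cdf. This makes the jump positive when
  \<open>0 < e\<close>.\<close>

lemma Phi_strict_mono:
  assumes "z < w"
  shows "Phi z < Phi w"
proof -
  interpret N: real_distribution std_normal_distribution by (rule real_dist_normal_dist)
  have "0 < cdf std_normal_distribution r" for r
    using std_normal_cdf_strict_mono[of "r - 1" r] N.cdf_nonneg[of "r - 1"] by simp
  moreover have "cdf std_normal_distribution r < 1" for r
    using std_normal_cdf_strict_mono[of r "r + 1"] N.cdf_bounded_prob[of "r + 1"] by simp
  ultimately show ?thesis
    using assms std_normal_cdf_strict_mono by (cases z; cases w) (auto simp: Phi_def)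
qed

section \<open>Thresholding estimators and bounds for their distribution functions\<close>

lemma threshold_estimators:
  assumes "a > 2" "est \<in> {hard_threshold, soft_threshold, scad a}" "\<eta> > 0"
  shows "est \<eta> \<in> borel_measurable borel"
    and "x \<le> \<eta> \<Longrightarrow> est \<eta> x \<le> 0"
    and "- \<eta> \<le> x \<Longrightarrow> 0 \<le> est \<eta> x"
proof -
  have sgn: "(sgn :: real \<Rightarrow> real) \<in> borel_measurable borel"
    unfolding sgn_if by measurable
  show "est \<eta> \<in> borel_measurable borel"
    using assms(2) sgn
    by (auto simp: hard_threshold_def[abs_def] soft_threshold_def[abs_def] scad_def[abs_def])
  \<comment> \<open>Gives the sign of the middle branch of SCAD, since \<open>2 * (a - 1)\<close>
    exceeds \<open>a\<close>; negative arguments use the instance at \<open>- x\<close>.\<close>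
  have "2 * \<eta> < x \<Longrightarrow> a * \<eta> \<le> (a - 1) * x" for x
  proof -
    assume "2 * \<eta> < x"
    then have "(a - 1) * (2 * \<eta>) \<le> (a - 1) * x"
      using assms by (intro mult_left_mono) auto
    moreover have "0 \<le> (a - 2) * \<eta>" using assms by simp
    ultimately show ?thesis by (simp add: algebra_simps)
  qed
  note this[of x] this[of "- x"]
  then show "x \<le> \<eta> \<Longrightarrow> est \<eta> x \<le> 0" "- \<eta> \<le> x \<Longrightarrow> 0 \<le> est \<eta> x"
    using assms
    by (auto simp: hard_threshold_def soft_threshold_def scad_def sgn_if divide_le_0_iff abs_if)
qed

lemma scaled_cdf_eq_measure:
  assumes "est (\<eta> n) \<in> borel_measurable borel"
  shows "scaled_cdf est \<eta> n \<theta> t = measure (sample_measure n \<theta>)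
    {y \<in> space (sample_measure n \<theta>). sqrt n * (est (\<eta> n) (sample_mean n y) - \<theta>) \<le> t}"
proof -
  note [measurable] = assms
  show ?thesis
    unfolding scaled_cdf_def cdf_def
    by (subst measure_distr) (auto intro!: arg_cong[where f = "measure _"])
qed

text \<open>A sample mean of at most \<open>\<eta> n\<close> gives a nonpositive estimate, whose
  scaled error is at most \<open>- sqrt n * \<theta>\<close>, hence at most
  \<open>t\<close>.\<close>

lemma scaled_cdf_ge:
  assumes "n \<ge> 1" and meas: "est (\<eta> n) \<in> borel_measurable borel"
    and nonpos: "\<And>x. x \<le> \<eta> n \<Longrightarrow> est (\<eta> n) x \<le> 0"
    and "0 \<le> t + sqrt n * \<theta>"
  shows "cdf std_normal_distribution (sqrt n * (\<eta> n - \<theta>)) \<le> scaled_cdf est \<eta> n \<theta> t"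
proof -
  interpret S: prob_space "sample_measure n \<theta>" by (rule prob_space_sample_measure)
  note [measurable] = meas
  have "sqrt n * (est (\<eta> n) x - \<theta>) \<le> t" if "x \<le> \<eta> n" for x
    using mult_nonneg_nonpos[OF _ nonpos[OF that], of "sqrt n"] assms(4) by (simp add: algebra_simps)
  then show ?thesis
    unfolding measure_sample_mean_le[OF assms(1), symmetric] scaled_cdf_eq_measure[where est = est and \<eta> = \<eta>, OF meas]
  proof (intro S.finite_measure_mono)
    show "{y \<in> space (sample_measure n \<theta>). sqrt n * (est (\<eta> n) (sample_mean n y) - \<theta>) \<le> t} \<in> sets (sample_measure n \<theta>)"
      by measurable
  qed auto
qed

text \<open>The other side of the jump: a scaled error of at most \<open>t\<close> now forces a
  negative estimate, hence a sample mean below \<open>- \<eta> n\<close>.\<close>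

lemma scaled_cdf_le:
  assumes "n \<ge> 1" and meas: "est (\<eta> n) \<in> borel_measurable borel"
    and nonneg: "\<And>x. - \<eta> n \<le> x \<Longrightarrow> 0 \<le> est (\<eta> n) x"
    and "t + sqrt n * \<theta> < 0"
  shows "scaled_cdf est \<eta> n \<theta> t \<le> cdf std_normal_distribution (sqrt n * (- \<eta> n - \<theta>))"
proof -
  interpret S: prob_space "sample_measure n \<theta>" by (rule prob_space_sample_measure)
  note [measurable] = meas
  have "x \<le> - \<eta> n" if "sqrt n * (est (\<eta> n) x - \<theta>) \<le> t" for x
  proof (rule ccontr)
    assume "\<not> x \<le> - \<eta> n"
    then have "0 \<le> sqrt n * est (\<eta> n) x" using nonneg[of x] by simp
    then show False using that assms(4) by (simp add: algebra_simps)
  qed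
  then show ?thesis
    unfolding measure_sample_mean_le[OF assms(1), symmetric] scaled_cdf_eq_measure[where est = est and \<eta> = \<eta>, OF meas]
  proof (intro S.finite_measure_mono)
    show "{y \<in> space (sample_measure n \<theta>). sample_mean n y \<le> - \<eta> n} \<in> sets (sample_measure n \<theta>)"
      by measurable
  qed auto
qed

section \<open>Error probabilities and the two-point argument\<close>

lemma error_prob_le_1: "error_prob Fhat G n \<theta> \<delta> \<le> 1"
  unfolding error_prob_def by (intro prob_space.prob_le_1 prob_space_sample_measure)

lemma bdd_above_error_prob: "bdd_above ((\<lambda>\<theta>. error_prob Fhat G n \<theta> \<delta>) ` S)"
  by (intro bdd_aboveI[of _ 1]) (auto intro: error_prob_le_1)

lemma uniformly_consistent_imp_consistent:
  assumes "uniformly_consistent Fhat G"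
  shows "consistent Fhat G"
  unfolding consistent_def
proof (intro allI impI)
  fix \<theta> \<delta> :: real assume "\<delta> > 0"
  then have "(\<lambda>n. SUP \<theta>. error_prob Fhat G n \<theta> \<delta>) \<longlonglongrightarrow> 0"
    using assms by (simp add: uniformly_consistent_def)
  then show "(\<lambda>n. error_prob Fhat G n \<theta> \<delta>) \<longlonglongrightarrow> 0"
    by (rule tendsto_sandwich[OF _ _ tendsto_const, rotated 2])
       (auto simp: error_prob_def intro!: always_eventually cSUP_upper[OF _ bdd_above_error_prob[unfolded error_prob_def]])
qed

text \<open>Where \<open>Fhat n\<close> is within \<open>m\<close> of \<open>g\<close>, the triangle
  inequality leaves it more than \<open>\<epsilon>\<close> away from \<open>G n \<theta>\<close>. It
  is applied with \<open>g = G n 0\<close>.\<close>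

lemma error_prob_ge:
  assumes Fhat: "Fhat n \<in> borel_measurable (\<Pi>\<^sub>M i\<in>{1..n}. borel)"
    and gap: "\<epsilon> + m < \<bar>G n \<theta> - g\<bar>"
  shows "1 - measure (sample_measure n \<theta>) {y \<in> space (sample_measure n \<theta>). m < \<bar>Fhat n y - g\<bar>}
    \<le> error_prob Fhat G n \<theta> \<epsilon>"
proof -
  interpret S: prob_space "sample_measure n \<theta>" by (rule prob_space_sample_measure)
  note [measurable] = Fhat
  let ?B = "{y \<in> space (sample_measure n \<theta>). m < \<bar>Fhat n y - g\<bar>}"
  have "1 - S.prob ?B = S.prob (space (sample_measure n \<theta>) - ?B)"
    by (intro S.prob_compl[symmetric]) measurable
  also have "\<dots> \<le> error_prob Fhat G n \<theta> \<epsilon>"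
    unfolding error_prob_def
  proof (rule S.finite_measure_mono)
    show "{y \<in> space (sample_measure n \<theta>). \<epsilon> < \<bar>Fhat n y - G n \<theta>\<bar>} \<in> sets (sample_measure n \<theta>)"
      by measurable
  qed (use gap in auto)
  finally show ?thesis .
qed

text \<open>Consistency at zero and contiguity put \<open>Fhat n\<close> near \<open>G n 0\<close>
  under both local parameters. Their target values are too far apart for both to lie within
  \<open>\<epsilon> + m\<close> of that number. The sequence \<open>G n 0\<close> itself need not
  converge.\<close>

lemma local_error_prob_tendsto_1:
  fixes \<theta>1 \<theta>2 :: "nat \<Rightarrow> real"
  assumes Fhat: "estimator Fhat"
    and cons: "consistent Fhat G"
    and \<theta>1: "\<And>n. n \<ge> 1 \<Longrightarrow> sqrt n * \<bar>\<theta>1 n\<bar> \<le> b"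
    and \<theta>2: "\<And>n. n \<ge> 1 \<Longrightarrow> sqrt n * \<bar>\<theta>2 n\<bar> \<le> b"
    and S: "\<forall>\<^sub>F n in sequentially. \<theta>1 n \<in> S n \<and> \<theta>2 n \<in> S n"
    and "m > 0"
    and gap: "\<forall>\<^sub>F n in sequentially. 2 * (\<epsilon> + m) < G n (\<theta>1 n) - G n (\<theta>2 n)"
  shows "(\<lambda>n. SUP \<theta>\<in>S n. error_prob Fhat G n \<theta> \<epsilon>) \<longlonglongrightarrow> 1"
proof (rule tendsto_sandwich)
  \<comment> \<open>The underlying space is the same for all parameters, so this one event can be
    evaluated under each sample measure.\<close>
  define A where "A n = {y \<in> space (\<Pi>\<^sub>M i\<in>{1..n}. borel). m < \<bar>Fhat n y - G n 0\<bar>}" for n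
  have A: "A n \<in> sets (\<Pi>\<^sub>M i\<in>{1..n}. borel)" if "n \<ge> 1" for n
  proof -
    have [measurable]: "Fhat n \<in> borel_measurable (\<Pi>\<^sub>M i\<in>{1..n}. borel)"
      using Fhat that by (simp add: estimator_def)
    show ?thesis unfolding A_def by measurable
  qed
  have A0: "(\<lambda>n. measure (sample_measure n 0) (A n)) \<longlonglongrightarrow> 0"
    using cons \<open>m > 0\<close> by (simp add: consistent_def error_prob_def A_def space_sample_measure)
  \<comment> \<open>Which parameter has the large error may change with \<open>n\<close>;
    subtracting both probabilities covers either case.\<close>
  let ?l = "\<lambda>n. 1 - (measure (sample_measure n (\<theta>1 n)) (A n) + measure (sample_measure n (\<theta>2 n)) (A n))"
  have "?l \<longlonglongrightarrow> 1 - (0 + 0)"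
    by (intro tendsto_intros tendsto_measure_sample_measure_zero[OF A A0, of _ b] \<theta>1 \<theta>2)
  then show "?l \<longlonglongrightarrow> 1" by simp
  show "\<forall>\<^sub>F n in sequentially. ?l n \<le> (SUP \<theta>\<in>S n. error_prob Fhat G n \<theta> \<epsilon>)"
    using S gap eventually_ge_at_top[of 1]
  proof eventually_elim
    case (elim n)
    have Fhat_n: "Fhat n \<in> borel_measurable (\<Pi>\<^sub>M i\<in>{1..n}. borel)"
      using Fhat elim by (simp add: estimator_def)
    obtain \<theta> where \<theta>: "\<theta> = \<theta>1 n \<or> \<theta> = \<theta>2 n" "\<epsilon> + m < \<bar>G n \<theta> - G n 0\<bar>"
      using elim(2) by (cases "\<epsilon> + m < \<bar>G n (\<theta>1 n) - G n 0\<bar>") force+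
    have "?l n \<le> 1 - measure (sample_measure n \<theta>) (A n)"
      using \<theta>(1) by (auto simp: measure_nonneg)
    also have "\<dots> \<le> error_prob Fhat G n \<theta> \<epsilon>"
      using error_prob_ge[where Fhat = Fhat and G = G, OF Fhat_n \<theta>(2)] by (simp add: A_def space_sample_measure)
    also have "\<dots> \<le> (SUP \<theta>\<in>S n. error_prob Fhat G n \<theta> \<epsilon>)"
      using elim(1) \<theta>(1) by (intro cSUP_upper bdd_above_error_prob) auto
    finally show ?case .
  qed
  show "\<forall>\<^sub>F n in sequentially. (SUP \<theta>\<in>S n. error_prob Fhat G n \<theta> \<epsilon>) \<le> 1"
    using S by eventually_elim (auto intro!: cSUP_least error_prob_le_1)
qed simp

text \<open>The second claim carries the guard \<open>0 < e\<close>: at \<open>e = 0\<close> both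
  values of \<open>Phi\<close> coincide, so the jump vanishes and the first claim admits only
  negative \<open>\<epsilon>\<close>.\<close>

theorem theorem15:
  fixes est :: "real \<Rightarrow> real \<Rightarrow> real" and \<eta> :: "nat \<Rightarrow> real"
    and a t :: real and e :: ereal
  assumes "a > 2"
    and "est \<in> {hard_threshold, soft_threshold, scad a}"
    and "\<And>n. n \<ge> 1 \<Longrightarrow> \<eta> n > 0"
    and "\<eta> \<longlonglongrightarrow> 0"
    and "0 \<le> e"
    and "(\<lambda>n. ereal (sqrt (real n) * \<eta> n)) \<longlonglongrightarrow> e"
  shows "(\<forall>Fhat. estimator Fhat \<and> consistent Fhat (\<lambda>n \<theta>. scaled_cdf est \<eta> n \<theta> t) \<longrightarrow>
            (\<forall>\<epsilon> c. \<epsilon> < (Phi (ereal t + e) - Phi (ereal t - e)) / 2 \<longrightarrow> c > \<bar>t\<bar> \<longrightarrow>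
              (\<lambda>n. SUP \<theta>\<in>{\<theta>. \<bar>\<theta>\<bar> < c / sqrt (real n)}.
                     error_prob Fhat (\<lambda>n \<theta>. scaled_cdf est \<eta> n \<theta> t) n \<theta> \<epsilon>) \<longlonglongrightarrow> 1))
       \<and> (0 < e \<longrightarrow>
            \<not> (\<exists>Fhat. estimator Fhat \<and>
                  uniformly_consistent Fhat (\<lambda>n \<theta>. scaled_cdf est \<eta> n \<theta> t)))"
proof -
  let ?G = "\<lambda>n \<theta>. scaled_cdf est \<eta> n \<theta> t"
  let ?D = "Phi (ereal t + e) - Phi (ereal t - e)"
  \<comment> \<open>\<open>?\<theta>1\<close> attains the boundary
    \<open>t + sqrt n * \<theta> = 0\<close> allowed in \<open>scaled_cdf_ge\<close>. The strict
    inequality in \<open>scaled_cdf_le\<close> is secured by the extra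
    \<open>inverse (real n)\<close> in \<open>?\<theta>2\<close>, which vanishes in the
    limit.\<close>
  let ?\<theta>1 = "\<lambda>n. - t / sqrt (real n)" and ?\<theta>2 = "\<lambda>n. - (t + inverse (real n)) / sqrt (real n)"
  \<comment> \<open>From here on the estimators enter only through measurability and the two sign
    conditions, so all three are treated at once.\<close>
  note est = threshold_estimators[OF assms(1,2,3)]
  have gap: "\<forall>\<^sub>F n in sequentially. d < ?G n (?\<theta>1 n) - ?G n (?\<theta>2 n)" if "d < ?D" for d
  proof -
    \<comment> \<open>The arguments of the two cdf bounds at \<open>?\<theta>1\<close> and
      \<open>?\<theta>2\<close>.\<close>
    let ?x = "\<lambda>n. t + sqrt (real n) * \<eta> n"
    let ?y = "\<lambda>n. t + inverse (real n) - sqrt (real n) * \<eta> n"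
    have "(\<lambda>n. ereal t + ereal (sqrt (real n) * \<eta> n)) \<longlonglongrightarrow> ereal t + e"
      by (intro tendsto_intros assms) auto
    then have x: "(\<lambda>n. ereal (?x n)) \<longlonglongrightarrow> ereal t + e" by simp
    have inv: "(\<lambda>n. ereal (t + inverse (real n))) \<longlonglongrightarrow> ereal t"
      using tendsto_add[OF tendsto_const[of t] lim_inverse_n] by simp
    \<comment> \<open>The first summand has a finite limit, so the limit of the sum is well
      determined even for infinite \<open>e\<close>.\<close>
    have "(\<lambda>n. ereal (t + inverse (real n)) + - ereal (sqrt (real n) * \<eta> n)) \<longlonglongrightarrow> ereal t + - e"
      by (intro tendsto_add_ereal_general2 inv tendsto_uminus_ereal assms) auto
    then have y: "(\<lambda>n. ereal (?y n)) \<longlonglongrightarrow> ereal t - e" by (simp add: minus_ereal_def)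
    have "(\<lambda>n. cdf std_normal_distribution (?x n) - cdf std_normal_distribution (?y n)) \<longlonglongrightarrow> ?D"
      by (intro tendsto_diff tendsto_cdf_Phi x y)
    then have "\<forall>\<^sub>F n in sequentially.
        d < cdf std_normal_distribution (?x n) - cdf std_normal_distribution (?y n)"
      using that by (rule order_tendstoD)
    then show ?thesis
      using eventually_ge_at_top[of 1]
    proof eventually_elim
      case (elim n)
      have "cdf std_normal_distribution (?x n) \<le> ?G n (?\<theta>1 n)"
        using scaled_cdf_ge[where \<theta> = "?\<theta>1 n" and t = t and est = est and \<eta> = \<eta>, OF elim(2) est(1,2)] elim(2)
        by (simp add: distrib_left add.commute)
      moreover have "?G n (?\<theta>2 n) \<le> cdf std_normal_distribution (?y n)"
      proof -
        have \<theta>2: "sqrt n * ?\<theta>2 n = - (t + inverse n)"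
          using elim(2) by simp
        then have "t + sqrt n * ?\<theta>2 n < 0" using elim(2) by simp
        moreover have "sqrt n * (- \<eta> n - ?\<theta>2 n) = ?y n"
          unfolding right_diff_distrib \<theta>2 by simp
        ultimately show ?thesis
          using scaled_cdf_le[where \<theta> = "?\<theta>2 n" and t = t and est = est and \<eta> = \<eta>, OF elim(2) est(1,3)] elim(2)
          by simp
      qed
      ultimately show ?case using elim(1) by linarith
    qed
  qed
  have local: "(\<lambda>n. SUP \<theta>\<in>{\<theta>. \<bar>\<theta>\<bar> < c / sqrt (real n)}. error_prob Fhat ?G n \<theta> \<epsilon>) \<longlonglongrightarrow> 1"
    if Fhat: "estimator Fhat" "consistent Fhat ?G" and \<epsilon>: "\<epsilon> < ?D / 2" and c: "c > \<bar>t\<bar>" for Fhat \<epsilon> c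
  proof -
    \<comment> \<open>Puts \<open>\<epsilon> + m\<close> midway between \<open>\<epsilon>\<close>
      and \<open>?D / 2\<close>, so that twice it stays below \<open>?D\<close>.\<close>
    define m where "m = (?D / 2 - \<epsilon>) / 2"
    have m: "m > 0" "2 * (\<epsilon> + m) < ?D" using \<epsilon> by (auto simp: m_def field_simps)
    \<comment> \<open>The strict inequality \<open>\<bar>t\<bar> < c\<close> leaves room for the
      shift in \<open>?\<theta>2\<close> once \<open>n\<close> is large.\<close>
    have "\<forall>\<^sub>F n in sequentially. inverse (real n) < c - \<bar>t\<bar>"
      using c by (intro order_tendstoD(2)[OF lim_inverse_n]) simp
    then have S: "\<forall>\<^sub>F n in sequentially. ?\<theta>1 n \<in> {\<theta>. \<bar>\<theta>\<bar> < c / sqrt (real n)} \<and>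
        ?\<theta>2 n \<in> {\<theta>. \<bar>\<theta>\<bar> < c / sqrt (real n)}"
      using eventually_ge_at_top[of 1]
    proof eventually_elim
      case (elim n)
      then have "0 < inverse (real n)" by simp
      with elim(1) have "\<bar>t + inverse (real n)\<bar> < c" by linarith
      with elim c show ?case by (simp add: abs_divide divide_strict_right_mono)
    qed
    have b: "inverse (real n) \<le> 1" if "n \<ge> 1" for n
      using that by (simp add: inverse_le_1_iff)
    show ?thesis
    proof (rule local_error_prob_tendsto_1[OF Fhat _ _ S m(1) gap[OF m(2)], where b = "\<bar>t\<bar> + 1"])
      fix n :: nat assume n: "n \<ge> 1"
      then show "sqrt n * \<bar>?\<theta>1 n\<bar> \<le> \<bar>t\<bar> + 1" by (simp add: abs_divide)
      have "\<bar>t + inverse (real n)\<bar> \<le> \<bar>t\<bar> + 1" using b[OF n] by (auto intro: order_trans[OF abs_triangle_ineq])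
      then show "sqrt n * \<bar>?\<theta>2 n\<bar> \<le> \<bar>t\<bar> + 1" using n by (simp add: abs_divide)
    qed
  qed
  have "\<not> uniformly_consistent Fhat ?G" if "0 < e" "estimator Fhat" for Fhat
  proof
    assume uc: "uniformly_consistent Fhat ?G"
    have "ereal t - e < ereal t + e" using \<open>0 < e\<close> by (cases e) auto
    then have D: "?D > 0" using Phi_strict_mono by simp
    \<comment> \<open>\<open>?D / 4\<close> is positive, as uniform consistency requires, and below
      \<open>?D / 2\<close>, as \<open>local\<close> requires.\<close>
    let ?sup = "\<lambda>S n. SUP \<theta>\<in>S. error_prob Fhat ?G n \<theta> (?D / 4)"
    have "(\<lambda>n. ?sup {\<theta>. \<bar>\<theta>\<bar> < (\<bar>t\<bar> + 1) / sqrt (real n)} n) \<longlonglongrightarrow> 1"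
      using that uniformly_consistent_imp_consistent[OF uc] D by (intro local) auto
    moreover have "(\<lambda>n. ?sup UNIV n) \<longlonglongrightarrow> 0"
      using uc D by (simp add: uniformly_consistent_def)
    moreover have "\<forall>\<^sub>F n in sequentially. ?sup {\<theta>. \<bar>\<theta>\<bar> < (\<bar>t\<bar> + 1) / sqrt (real n)} n \<le> ?sup UNIV n"
      using eventually_ge_at_top[of 1]
    proof eventually_elim
      case (elim n)
      then have "0 \<in> {\<theta>. \<bar>\<theta>\<bar> < (\<bar>t\<bar> + 1) / sqrt (real n)}" by simp
      then have "{\<theta>. \<bar>\<theta>\<bar> < (\<bar>t\<bar> + 1) / sqrt (real n)} \<noteq> {}" by blast
      then show ?case by (intro cSUP_subset_mono bdd_above_error_prob) auto
    qed
    ultimately have "(1::real) \<le> 0"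
      by (intro tendsto_le[OF sequentially_bot])
    then show False by simp
  qed
  with local show ?thesis by blast
qed

end
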